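(* Let $\tfrac{1}{12}<\delta<\tfrac16$ and let \[ q=1-2\delta-\frac{1}{\left\lceil \frac{2}{1-2\delta}\right\rceil}. \] Then no deterministic online algorithm for the Online Simple Knapsack problem with item size estimates and additive estimate accuracy $\delta$ has competitive ratio smaller than $\frac1q$.
   Context: Online Simple Knapsack with Item Size Estimates (additive accuracy $\delta\ge 0$): an instance consists of actual item sizes $x_1,\dots,x_n\in[0,1]$ together with estimated sizes $x_1',\dots,x_n'$ satisfying $x_i'-\delta\le x_i\le x_i'+\delta$ for all $i$. A deterministic online algorithm knows $\delta$ and the whole list of estimates $x_1',\dots,x_n'$ from the start. The actual sizes are then revealed one at a time in order. When $x_i$ is revealed, the algorithm must irrevocably either pack it into an initially empty knapsack of capacity $1$ (allowed only if the total size already packed plus $x_i$ is at most $1$) or reject it. The gain of an algorithm is the total size of the packed items. The optimal gain $\mathrm{OPT}$ of an instance is the maximum total size of a subset of the actual items with total size at most $1$. The competitive ratio of an algorithm $A$ is $\sup \mathrm{OPT}/\mathrm{gain}_A$, the supremum over all instances with accuracy $\delta$. *)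

theory Defs
  imports Complex_Main "HOL-Library.Extended_Real"
begin

text \<open>
  Items are indexed from 0; \<open>es\<close> is the list of estimates and \<open>xs\<close> the list of actual sizes.
\<close>

definition knapsack_instance :: "real \<Rightarrow> real list \<Rightarrow> real list \<Rightarrow> bool" where
  "knapsack_instance \<delta> es xs \<longleftrightarrow>
     length es = length xs \<and>
     (\<forall>i < length xs. 0 \<le> xs ! i \<and> xs ! i \<le> 1 \<and>
        es ! i - \<delta> \<le> xs ! i \<and> xs ! i \<le> es ! i + \<delta>)"

text \<open>
  The decision on the current item is a function of all estimates and of the actual sizes
  revealed so far, whose last entry is the current item. The algorithm's own earlier decisions
  are determined by this data, so they are not a separate argument. Knowledge of \<open>\<delta>\<close>
  is reflected by choosing the algorithm for a given \<open>\<delta>\<close>.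
\<close>

type_synonym decision_rule = "real list \<Rightarrow> real list \<Rightarrow> bool"

definition packed :: "decision_rule \<Rightarrow> real list \<Rightarrow> real list \<Rightarrow> nat set" where
  "packed A es xs = {i. i < length xs \<and> A es (take (Suc i) xs)}"

definition gain :: "decision_rule \<Rightarrow> real list \<Rightarrow> real list \<Rightarrow> real" where
  "gain A es xs = (\<Sum>i \<in> packed A es xs. xs ! i)"

definition online_algorithm :: "real \<Rightarrow> decision_rule \<Rightarrow> bool" where
  "online_algorithm \<delta> A \<longleftrightarrow>
     (\<forall>es xs. knapsack_instance \<delta> es xs \<longrightarrow>
        (\<forall>i \<in> packed A es xs.
           (\<Sum>j \<in> {j \<in> packed A es xs. j < i}. xs ! j) + xs ! i \<le> 1))"

definition opt :: "real list \<Rightarrow> real" where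
  "opt xs = Max {(\<Sum>i \<in> S. xs ! i) | S. S \<subseteq> {..<length xs} \<and> (\<Sum>i \<in> S. xs ! i) \<le> 1}"

text \<open>
  In \<^typ>\<open>ereal\<close>, \<open>a / 0 = \<infinity>\<close> for \<open>a > 0\<close>, so an instance with positive optimum and gain 0
  makes the ratio infinite. An instance with optimum 0 contributes \<open>0 / 0 = 0\<close>; this does not
  affect the supremum, since every instance with positive optimum contributes at least 1.
\<close>

definition competitive_ratio :: "real \<Rightarrow> decision_rule \<Rightarrow> ereal" where
  "competitive_ratio \<delta> A =
     (SUP (es, xs) \<in> {(es, xs). knapsack_instance \<delta> es xs}.
        ereal (opt xs) / ereal (gain A es xs))"

end

theory Submission
  imports Defs
begin

text \<open>
  For \<open>1/12 < \<delta> < 1/6\<close> the ceiling is 3, so \<open>q = 2/3 - 2\<delta>\<close>. The adversary announces \<open>N\<close> items of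
  estimate \<open>\<delta>\<close> and three of estimate \<open>1/3 + \<delta>\<close>. It first reveals grains of size \<open>\<gamma> = 1/N\<close> until the
  algorithm has packed an amount \<open>s > q - 1/3\<close>, and items of size 0 after that. If the threshold is
  never passed, the grains alone fill a knapsack, and the adversary sets \<open>b = q - s + \<gamma>\<close>; otherwise
  \<open>b = 1/3\<close>. The remaining items have size \<open>b\<close> until the algorithm packs one of them. From then on
  they have size \<open>1 - q = 1/3 + 2\<delta>\<close>, which no longer fits. The algorithm ends with at most \<open>q + \<gamma>\<close>,
  while the optimum is at least \<open>1 - \<gamma>\<close>: it uses the grains alone, or three items of size \<open>1/3\<close>, or
  one item of size \<open>1/3\<close>, one of size \<open>1 - q\<close>, and packed grains of total size almost \<open>q - 1/3\<close>.
\<close>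

section \<open>Subset sums as lower bounds on the optimum\<close>

definition subset_sum :: "real list \<Rightarrow> real \<Rightarrow> bool" where
  "subset_sum xs v \<longleftrightarrow> (\<exists>S \<subseteq> {..<length xs}. v = (\<Sum>i \<in> S. xs ! i))"

lemma subset_sum_empty: "subset_sum xs 0"
  unfolding subset_sum_def by (intro exI[of _ "{}"]) auto

lemma subset_sum_snoc_skip:
  assumes "subset_sum xs v"
  shows "subset_sum (xs @ [x]) v"
proof -
  obtain S where S: "S \<subseteq> {..<length xs}" "v = (\<Sum>i \<in> S. xs ! i)"
    using assms unfolding subset_sum_def by blast
  have "(\<Sum>i \<in> S. (xs @ [x]) ! i) = (\<Sum>i \<in> S. xs ! i)"
    using S(1) by (intro sum.cong) (auto simp: nth_append)
  then show ?thesis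
    unfolding subset_sum_def using S by (intro exI[of _ S]) auto
qed

lemma subset_sum_snoc_take:
  assumes "subset_sum xs v"
  shows "subset_sum (xs @ [x]) (v + x)"
proof -
  obtain S where S: "S \<subseteq> {..<length xs}" "v = (\<Sum>i \<in> S. xs ! i)"
    using assms unfolding subset_sum_def by blast
  have "(\<Sum>i \<in> S. (xs @ [x]) ! i) = (\<Sum>i \<in> S. xs ! i)"
    using S(1) by (intro sum.cong) (auto simp: nth_append)
  moreover have "finite S" "length xs \<notin> S"
    using S(1) finite_subset by auto
  ultimately show ?thesis
    unfolding subset_sum_def using S
    by (intro exI[of _ "insert (length xs) S"]) auto
qed

lemma subset_sum_append:
  assumes "subset_sum xs v"
  shows "subset_sum (xs @ ys) v"
proof (induction ys rule: rev_induct)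
  case Nil
  then show ?case using assms by simp
next
  case (snoc y ys)
  then show ?case using subset_sum_snoc_skip[of "xs @ ys" v y] by simp
qed

lemma subset_sum_replicate: "subset_sum (replicate n x) (real n * x)"
proof (induction n)
  case 0
  then show ?case using subset_sum_empty by simp
next
  case (Suc n)
  then show ?case
    using subset_sum_snoc_take[of "replicate n x" "real n * x" x]
    by (simp add: replicate_append_same algebra_simps)
qed

lemma subset_sum_gain: "subset_sum xs (gain A es xs)"
  unfolding subset_sum_def
  by (intro exI[of _ "packed A es xs"]) (auto simp: gain_def packed_def)

lemma opt_ge:
  assumes "subset_sum xs v" "v \<le> 1"
  shows "v \<le> opt xs"
proof -
  have "finite {(\<Sum>i \<in> S. xs ! i) | S. S \<subseteq> {..<length xs} \<and> (\<Sum>i \<in> S. xs ! i) \<le> 1}"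
    by (rule finite_subset[of _ "(\<lambda>S. \<Sum>i \<in> S. xs ! i) ` Pow {..<length xs}"]) auto
  then show ?thesis
    unfolding opt_def using assms by (intro Max_ge) (auto simp: subset_sum_def)
qed

section \<open>The gain along prefixes\<close>

lemma gain_Nil [simp]: "gain A es [] = 0"
  by (simp add: gain_def packed_def)

lemma packed_append:
  "{j \<in> packed A es (xs @ ys). j < length xs} = packed A es xs"
  by (auto simp: packed_def)

lemma gain_prefix:
  "gain A es xs = (\<Sum>j \<in> {j \<in> packed A es (xs @ ys). j < length xs}. (xs @ ys) ! j)"
  unfolding packed_append gain_def
  by (intro sum.cong) (auto simp: packed_def nth_append)

lemma gain_snoc:
  "gain A es (xs @ [x]) = gain A es xs + (if A es (xs @ [x]) then x else 0)"
proof -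
  have fin: "finite (packed A es xs)" and notin: "length xs \<notin> packed A es xs"
    by (auto simp: packed_def)
  have *: "packed A es (xs @ [x]) =
    (if A es (xs @ [x]) then insert (length xs) (packed A es xs) else packed A es xs)"
    by (auto simp: packed_def less_Suc_eq)
  have "(\<Sum>i \<in> packed A es xs. (xs @ [x]) ! i) = gain A es xs"
    unfolding gain_def by (intro sum.cong) (auto simp: packed_def nth_append)
  then show ?thesis
    unfolding gain_def[of A es "xs @ [x]"] * using fin notin by simp
qed

text \<open>Even if packed, items of size 0 add nothing, so they dispose of the leftover grain
  estimates whatever the algorithm decides.\<close>

lemma gain_append_zeros: "gain A es (xs @ replicate n 0) = gain A es xs"
proof (induction n)
  case (Suc n)
  then show ?case
    using gain_snoc[of A es "xs @ replicate n 0" 0]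
    by (simp add: replicate_append_same)
qed simp

lemma gain_nonneg:
  assumes "\<And>x. x \<in> set xs \<Longrightarrow> 0 \<le> x"
  shows "0 \<le> gain A es xs"
  using assms unfolding gain_def by (intro sum_nonneg) (auto simp: packed_def)

text \<open>Decisions depend only on revealed sizes, so feasibility on the whole instance bounds the
  gain on a prefix. Read contrapositively: an item that would overflow is rejected.\<close>

lemma packed_item_fits:
  assumes "online_algorithm \<delta> A" "knapsack_instance \<delta> es (xs @ x # ys)"
    and "A es (xs @ [x])"
  shows "gain A es xs + x \<le> 1"
proof -
  have "length xs \<in> packed A es (xs @ x # ys)"
    using assms(3) by (simp add: packed_def)
  then have "(\<Sum>j \<in> {j \<in> packed A es (xs @ x # ys). j < length xs}. (xs @ x # ys) ! j)
      + (xs @ x # ys) ! length xs \<le> 1"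
    using assms(1,2) unfolding online_algorithm_def by blast
  then show ?thesis
    using gain_prefix[of A es xs "x # ys"] by simp
qed

lemma knapsack_instance_list_all2:
  "knapsack_instance \<delta> es xs \<longleftrightarrow>
     list_all2 (\<lambda>e x. 0 \<le> x \<and> x \<le> 1 \<and> e - \<delta> \<le> x \<and> x \<le> e + \<delta>) es xs"
  by (auto simp: knapsack_instance_def list_all2_conv_all_nth)

lemma knapsack_instance_append:
  assumes "knapsack_instance \<delta> es xs" "knapsack_instance \<delta> es' xs'"
  shows "knapsack_instance \<delta> (es @ es') (xs @ xs')"
  using assms unfolding knapsack_instance_list_all2 by (rule list_all2_appendI)

section \<open>The adversary\<close>

text \<open>By \<open>blocked\<close>, no \<open>B\<close> fits once a \<open>b\<close> is packed,
  so at most one of the three items is taken. The lists in \<open>opt\<close> answer the algorithm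
  packing the first item, the second, or neither of these.\<close>

lemma three_item_adversary:
  fixes b B :: real
  assumes alg: "online_algorithm \<delta> A"
    and es: "es = es0 @ replicate 3 e"
    and inst: "knapsack_instance \<delta> es0 xs0"
    and b: "0 \<le> b" "b \<le> 1" "e - \<delta> \<le> b" "b \<le> e + \<delta>"
    and B: "0 \<le> B" "B \<le> 1" "e - \<delta> \<le> B" "B \<le> e + \<delta>"
    and blocked: "gain A es xs0 + b + B > 1"
    and opt: "\<And>v. v \<in> {[b, B, B], [b, b, B], [b, b, b]} \<Longrightarrow> p \<le> opt (xs0 @ v)"
  shows "\<exists>xs. knapsack_instance \<delta> es xs \<and> p \<le> opt xs \<and> gain A es xs \<le> gain A es xs0 + b"
proof -
  have three: "replicate 3 e = [e, e, e]"
    by (simp add: numeral_3_eq_3)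
  have inst': "knapsack_instance \<delta> es (xs0 @ v)" if "v \<in> {[b, B, B], [b, b, B], [b, b, b]}" for v
    unfolding es three using that b B
    by (intro knapsack_instance_append inst) (auto simp: knapsack_instance_list_all2)
  have step: "gain A es (ys @ [x, y]) = gain A es (ys @ [x]) + (if A es (ys @ [x, y]) then y else 0)"
    for ys x y using gain_snoc[of A es "ys @ [x]" y] by simp
  have step': "gain A es (ys @ [x, y, z])
      = gain A es (ys @ [x, y]) + (if A es (ys @ [x, y, z]) then z else 0)"
    for ys x y z using gain_snoc[of A es "ys @ [x, y]" z] by simp
  note gains = gain_snoc[of A es xs0] step[of xs0] step'[of xs0]
  consider (1) "A es (xs0 @ [b])" | (2) "\<not> A es (xs0 @ [b])" "A es (xs0 @ [b, b])"
    | (3) "\<not> A es (xs0 @ [b])" "\<not> A es (xs0 @ [b, b])" by blast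
  then show ?thesis
  proof cases
    case 1
    have "knapsack_instance \<delta> es (xs0 @ [b, B, B])" by (rule inst') simp
    then have "\<not> A es (xs0 @ [b, B])" "\<not> A es (xs0 @ [b, B, B])"
      using packed_item_fits[OF alg, of es "xs0 @ [b]" B "[B]"]
        packed_item_fits[OF alg, of es "xs0 @ [b, B]" B "[]"] 1 blocked B(1)
      by (auto simp: gains split: if_splits)
    then show ?thesis
      using 1 inst' opt by (intro exI[of _ "xs0 @ [b, B, B]"]) (auto simp: gains)
  next
    case 2
    have "knapsack_instance \<delta> es (xs0 @ [b, b, B])" by (rule inst') simp
    then have "\<not> A es (xs0 @ [b, b, B])"
      using packed_item_fits[OF alg, of es "xs0 @ [b, b]" B "[]"] 2 blocked
      by (auto simp: gains)
    then show ?thesis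
      using 2 inst' opt by (intro exI[of _ "xs0 @ [b, b, B]"]) (auto simp: gains)
  next
    \<comment> \<open>Whether or not the third \<open>b\<close> is packed, the gain grows by at most
      \<open>b\<close>.\<close>
    case 3
    then show ?thesis
      using b(1) inst' opt by (intro exI[of _ "xs0 @ [b, b, b]"]) (auto simp: gains)
  qed
qed

lemma adversary:
  fixes \<delta> q :: real
  assumes alg: "online_algorithm \<delta> A"
    and \<delta>: "1 / 12 < \<delta>" "\<delta> < 1 / 6" and q: "q = 2 / 3 - 2 * \<delta>"
    and N: "N > 0" and \<gamma>: "\<gamma> = 1 / real N" "\<gamma> \<le> 2 * \<delta>" "2 * q + \<gamma> \<le> 1"
  shows "\<exists>es xs. knapsack_instance \<delta> es xs \<and> 1 - \<gamma> \<le> opt xs \<and> gain A es xs \<le> q + \<gamma>"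
proof -
  \<comment> \<open>Estimate \<delta> admits sizes from 0 to 2\<delta>, hence both \<gamma> and 0.
    Estimate 1/3 + \<delta> admits sizes from 1/3 to 1/3 + 2\<delta> = 1 - q.\<close>
  define es0 where "es0 = replicate N \<delta>"
  define es where "es = es0 @ replicate 3 (1 / 3 + \<delta>)"
  define g where "g n = gain A es (replicate n \<gamma>)" for n
  \<comment> \<open>A packed amount s satisfies s + 1/3 + (1 - q) > 1 exactly if s >
    \<open>c\<close>.\<close>
  define c where "c = q - 1 / 3"
  have \<gamma>0: "0 < \<gamma>" and N\<gamma>: "real N * \<gamma> = 1" using N \<gamma>(1) by auto
  have \<gamma>1: "\<gamma> \<le> 1" using \<gamma>(2) \<delta> by simp
  have c0: "0 < c" using \<delta> by (simp add: c_def q)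
  have g0: "g 0 = 0" by (simp add: g_def)
  have gSuc: "g (Suc n) \<le> g n + \<gamma>" for n
    using gain_snoc[of A es "replicate n \<gamma>" \<gamma>] \<gamma>0
    by (simp add: g_def replicate_append_same split: if_splits)
  \<comment> \<open>The disjunct \<open>i = N\<close> makes the minimum exist even if the threshold
    is never passed; minimality keeps all earlier gains at most \<open>c\<close>.\<close>
  define i where "i = (LEAST i. i = N \<or> c < g i)"
  have i: "i = N \<or> c < g i" unfolding i_def by (rule LeastI[of _ N]) simp
  have i_le: "i \<le> N" unfolding i_def by (rule Least_le) simp
  have before: "g n \<le> c" if "n < i" for n
    using not_less_Least[OF that[unfolded i_def]] by auto
  define xs0 where "xs0 = replicate i \<gamma> @ replicate (N - i) 0"
  have s: "gain A es xs0 = g i" by (simp add: xs0_def g_def gain_append_zeros)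
  have inst: "knapsack_instance \<delta> es0 xs0"
    using \<gamma>0 \<gamma>1 \<gamma>(2) i_le \<delta>
    by (auto simp: knapsack_instance_def es0_def xs0_def nth_append)
  have B: "0 \<le> 1 - q" "1 - q \<le> 1" "1 / 3 + \<delta> - \<delta> \<le> 1 - q" "1 - q \<le> 1 / 3 + \<delta> + \<delta>"
    using \<delta> by (auto simp: q)
  show ?thesis
  proof (cases "c < g i")
    case False
    with i have iN: "i = N" by simp
    have gi: "0 \<le> g i" using \<gamma>0 unfolding g_def by (intro gain_nonneg) auto
    have "subset_sum xs0 1"
      using subset_sum_replicate[of N \<gamma>] N\<gamma> by (simp add: xs0_def iN)
    then have opt: "1 - \<gamma> \<le> opt (xs0 @ v)" for v
      using opt_ge[OF subset_sum_append, of xs0 1 v] \<gamma>0 by simp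
    \<comment> \<open>With b = q - \<open>g i\<close> + \<gamma>, the gain is at most q + \<gamma>,
      and \<open>g i\<close> + b + (1 - q) = 1 + \<gamma> overflows. Here b \<ge> 1/3 because
      \<open>g i\<close> \<le> \<open>c\<close>, and b \<le> 1 - q because 2q + \<gamma> \<le>
      1.\<close>
    have "\<exists>xs. knapsack_instance \<delta> es xs \<and> 1 - \<gamma> \<le> opt xs
        \<and> gain A es xs \<le> gain A es xs0 + (q - g i + \<gamma>)"
      by (rule three_item_adversary[OF alg es_def inst _ _ _ _ B])
        (use False gi \<gamma>0 \<gamma>(3) \<delta> opt in \<open>auto simp: s c_def q\<close>)
    then show ?thesis unfolding s by auto
  next
    case True
    then have "i \<noteq> 0" using g0 c0 by (metis less_asym)
    then obtain k where k: "i = Suc k" by (cases i) auto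
    \<comment> \<open>Omitting the grain that crosses the threshold leaves \<open>g k\<close> in
      (\<open>c\<close> - \<gamma>, \<open>c\<close>], so adding 1/3 and 1 - q gives a total in (1 -
      \<gamma>, 1].\<close>
    have gk: "g k \<le> c" "c - \<gamma> < g k" and gi: "g i \<le> c + \<gamma>"
      using before[of k] gSuc[of k] True k by auto
    have "xs0 = replicate k \<gamma> @ \<gamma> # replicate (N - i) 0"
      by (simp add: xs0_def k replicate_app_Cons_same)
    then have sub0: "subset_sum xs0 (g k)"
      unfolding g_def using subset_sum_append[OF subset_sum_gain] by metis
    have sub_bB: "subset_sum (xs0 @ [1 / 3, 1 - q, 1 - q]) (g k + 1 / 3 + (1 - q))"
      using subset_sum_append[OF subset_sum_snoc_take[OF subset_sum_snoc_take[OF sub0]],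
          of "1 / 3" "1 - q" "[1 - q]"] by simp
    have sub_bbB: "subset_sum (xs0 @ [1 / 3, 1 / 3, 1 - q]) (g k + 1 / 3 + (1 - q))"
      using subset_sum_snoc_take[OF subset_sum_snoc_skip[OF subset_sum_snoc_take[OF sub0]],
          of "1 / 3" "1 / 3" "1 - q"] by simp
    have sub_bbb: "subset_sum (xs0 @ [1 / 3, 1 / 3, 1 / 3]) 1"
      using subset_sum_snoc_take[OF subset_sum_snoc_take[OF subset_sum_snoc_take[OF
            subset_sum_empty]], of xs0 "1 / 3" "1 / 3" "1 / 3"] by simp
    have opt: "1 - \<gamma> \<le> opt (xs0 @ v)"
      if "v \<in> {[1 / 3, 1 - q, 1 - q], [1 / 3, 1 / 3, 1 - q], [1 / 3, 1 / 3, 1 / 3]}" for v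
      using that opt_ge[OF sub_bB] opt_ge[OF sub_bbB] opt_ge[OF sub_bbb] gk \<gamma>0
      by (auto simp: c_def)
    have "\<exists>xs. knapsack_instance \<delta> es xs \<and> 1 - \<gamma> \<le> opt xs
        \<and> gain A es xs \<le> gain A es xs0 + 1 / 3"
      by (rule three_item_adversary[OF alg es_def inst _ _ _ _ B])
        (use True \<delta> opt in \<open>auto simp: s c_def q\<close>)
    then show ?thesis unfolding s using gi by (fastforce simp: c_def)
  qed
qed

section \<open>From single instances to the competitive ratio\<close>

lemma competitive_ratio_ge:
  assumes inst: "knapsack_instance \<delta> es xs"
    and "0 < p" "p \<le> opt xs" "gain A es xs \<le> r" "0 < r"
  shows "ereal (p / r) \<le> competitive_ratio \<delta> A"
proof -
  have "ereal (p / r) \<le> ereal (opt xs) / ereal (gain A es xs)"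
  proof (cases "gain A es xs = 0")
    \<comment> \<open>The optimum is at least p > 0, so the quotient by zero gain is
      infinite.\<close>
    case True
    then show ?thesis using assms by (simp add: ereal_divide)
  next
    case False
    moreover have "0 \<le> gain A es xs"
      using inst by (intro gain_nonneg) (auto simp: knapsack_instance_def in_set_conv_nth)
    ultimately have "0 < gain A es xs" by simp
    then show ?thesis using assms by (simp add: frac_le)
  qed
  also have "\<dots> \<le> competitive_ratio \<delta> A"
    unfolding competitive_ratio_def
    by (rule SUP_upper2[of "(es, xs)"]) (use inst in auto)
  finally show ?thesis .
qed

theorem theorem6:
  fixes \<delta> q :: real
  assumes "1 / 12 < \<delta>" and "\<delta> < 1 / 6"
    and "q = 1 - 2 * \<delta> - 1 / real_of_int \<lceil>2 / (1 - 2 * \<delta>)\<rceil>"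
  shows "\<not> (\<exists>A. online_algorithm \<delta> A \<and> competitive_ratio \<delta> A < ereal (1 / q))"
proof
  assume "\<exists>A. online_algorithm \<delta> A \<and> competitive_ratio \<delta> A < ereal (1 / q)"
  then obtain A where alg: "online_algorithm \<delta> A"
    and less: "competitive_ratio \<delta> A < ereal (1 / q)" by blast
  \<comment> \<open>The quotient lies strictly between 12/5 and 3.\<close>
  have "\<lceil>2 / (1 - 2 * \<delta>)\<rceil> = 3"
    using assms(1,2) by (intro ceiling_unique) (auto simp: field_simps)
  then have q: "q = 2 / 3 - 2 * \<delta>" using assms(3) by simp
  \<comment> \<open>The bound 2q < 1 amounts to \<delta> > 1/12 and leaves room for grains with 2q +
    1/N \<le> 1.\<close>
  have q0: "0 < q" "2 * q < 1" using q assms(1,2) by auto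
  have inv0: "(\<lambda>N. 1 / real N) \<longlonglongrightarrow> 0" by (rule lim_1_over_n)
  have "\<forall>\<^sub>F N in sequentially. 1 / real N < min (2 * \<delta>) (1 - 2 * q)"
    using q0 assms(1) by (intro order_tendstoD(2)[OF inv0]) auto
  then have "\<forall>\<^sub>F N in sequentially.
      ereal ((1 - 1 / real N) / (q + 1 / real N)) \<le> competitive_ratio \<delta> A"
    using eventually_gt_at_top[of 0]
  proof eventually_elim
    case (elim N)
    then obtain es xs where *: "knapsack_instance \<delta> es xs" "1 - 1 / real N \<le> opt xs"
        "gain A es xs \<le> q + 1 / real N"
      using adversary[OF alg assms(1,2) q, of N "1 / real N"] by auto
    have "1 / real N < 1" using elim q0 by linarith
    moreover have "0 < q + 1 / real N" using q0 by (simp add: add_pos_nonneg)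
    ultimately show ?case using * by (intro competitive_ratio_ge) auto
  qed
  \<comment> \<open>Each large N gives a bound below 1/q; these bounds tend to 1/q.\<close>
  moreover have "(\<lambda>N. (1 - 1 / real N) / (q + 1 / real N)) \<longlonglongrightarrow> (1 - 0) / (q + 0)"
    using q0 by (intro tendsto_intros inv0) auto
  then have "(\<lambda>N. ereal ((1 - 1 / real N) / (q + 1 / real N))) \<longlonglongrightarrow> ereal (1 / q)"
    by (simp add: tendsto_ereal)
  ultimately have "ereal (1 / q) \<le> competitive_ratio \<delta> A"
    by (intro tendsto_upperbound) auto
  with less show False by simp
qed

end
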